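(* Let $d\in\mathbb{N}$ with $d\ge 2$, let $0<\pi\le 1$, let $\chi$ be the Binomial$(d,\pi)$ distribution, and let $(p,q)\in[0,1]^2$ with $0<p+q<1$. The probability that the bond percolation game with parameter-pair $(p,q)$, played on the rooted Galton-Watson tree $T_\chi$ starting from its root, results in a draw is $0$ if and only if $$(1-p-q)\,\pi\,(1-\pi q)^{d-1}\le (d+1)^{d-1}d^{-d}.$$
   Context: Here $\pi$ is a parameter (not the circle constant). $T_\chi$ is the rooted Galton-Watson tree with root $\phi$ in which the numbers of children of the vertices are i.i.d. with law $\chi$. Each edge $\{u,v\}$ ($u$ the parent of $v$) is directed from $u$ to $v$. Bond percolation game with parameter-pair $(p,q)$: given $T_\chi$, each edge is independently labeled trap with probability $p$, target with probability $q$, safe with probability $1-p-q$. The tree and all labels are revealed to both players (perfect information). Two players alternately move a token, initially at $\phi$; a move takes the token from its current vertex $u$ along a directed edge to a child of $u$. A player who moves the token along a target edge wins immediately; a player who moves it along a trap edge loses immediately; a player whose turn it is to move when the token is at a leaf (childless vertex) loses. If the game continues forever it is a draw. Both players play optimally: for a given realization, the game is won (respectively lost) by the first player if the first (respectively second) player has a strategy guaranteeing a win for herself in finitely many rounds against any play of the opponent; otherwise the game results in a draw. *)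

theory Defs
  imports "HOL-Probability.Probability"
begin

section \<open>The labelled Galton--Watson tree\<close>

text \<open>
  Vertices are Ulam--Harris words: the root is \<open>[]\<close>, and the children of \<open>v\<close> are \<open>v @ [i]\<close>
  for \<open>i < N v\<close>, where \<open>N v\<close> is the number of children of \<open>v\<close>.  The label of the edge from a
  vertex to its child \<open>v\<close> is \<open>L v\<close>; the value \<open>L []\<close> is never used.
\<close>

datatype edge_label = Trap | Target | Safe

type_synonym vertex = "nat list"

inductive_set gw_tree :: "(vertex \<Rightarrow> nat) \<Rightarrow> vertex set" for N where
  root: "[] \<in> gw_tree N"
| child: "v \<in> gw_tree N \<Longrightarrow> i < N v \<Longrightarrow> v @ [i] \<in> gw_tree N"

text \<open>Meaningful only if \<open>p\<close>, \<open>q\<close> and \<open>1 - p - q\<close> are nonnegative.\<close>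

definition edge_label_pmf :: "real \<Rightarrow> real \<Rightarrow> edge_label pmf" where
  "edge_label_pmf p q = pmf_of_list [(Trap, p), (Target, q), (Safe, 1 - p - q)]"

text \<open>
  Child counts and labels are attached independently to all words, including those that are not
  vertices of the realized tree; only the values on \<open>gw_tree N\<close> influence the game.  Since the
  labels are independent of \<open>N\<close>, they are i.i.d. on the edges of the tree given the tree.
\<close>

definition percolation_measure ::
    "nat pmf \<Rightarrow> real \<Rightarrow> real \<Rightarrow> ((vertex \<Rightarrow> nat) \<times> (vertex \<Rightarrow> edge_label)) measure" where
  "percolation_measure \<nu> p q =
     (\<Pi>\<^sub>M v\<in>UNIV. measure_pmf \<nu>) \<Otimes>\<^sub>M (\<Pi>\<^sub>M v\<in>UNIV. measure_pmf (edge_label_pmf p q))"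

section \<open>The bond percolation game\<close>

text \<open>
  A strategy picks, at each vertex, the index of the child to move to.  In a tree the position of
  the token determines the history of the play, so strategies depend on the position alone.
  Strategies may depend on the whole realization \<open>(N, L)\<close>, because they are quantified after it.
\<close>

definition valid_strategy :: "(vertex \<Rightarrow> nat) \<Rightarrow> (vertex \<Rightarrow> nat) \<Rightarrow> bool" where
  "valid_strategy N s \<longleftrightarrow> (\<forall>v\<in>gw_tree N. N v > 0 \<longrightarrow> s v < N v)"

text \<open>
  The token after \<open>n\<close> moves, when the first player follows \<open>s\<close> and the second player \<open>t\<close>; move
  number \<open>n\<close>, counted from \<open>0\<close>, is made by the first player iff \<open>n\<close> is even.  The sequence is
  continued past the end of the play, where its values are meaningless.
\<close>

primrec token :: "(vertex \<Rightarrow> nat) \<Rightarrow> (vertex \<Rightarrow> nat) \<Rightarrow> nat \<Rightarrow> vertex" where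
  "token s t 0 = []"
| "token s t (Suc n) = token s t n @ [(if even n then s else t) (token s t n)]"

definition undecided ::
    "(vertex \<Rightarrow> nat) \<Rightarrow> (vertex \<Rightarrow> edge_label) \<Rightarrow> (vertex \<Rightarrow> nat) \<Rightarrow> (vertex \<Rightarrow> nat) \<Rightarrow> nat \<Rightarrow> bool"
  where
  "undecided N L s t n \<longleftrightarrow> (\<forall>k<n. N (token s t k) > 0 \<and> L (token s t (Suc k)) = Safe)"

definition mover_wins ::
    "(vertex \<Rightarrow> nat) \<Rightarrow> (vertex \<Rightarrow> edge_label) \<Rightarrow> (vertex \<Rightarrow> nat) \<Rightarrow> (vertex \<Rightarrow> nat) \<Rightarrow> nat \<Rightarrow> bool"
  where
  "mover_wins N L s t n \<longleftrightarrow>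
     undecided N L s t n \<and> N (token s t n) > 0 \<and> L (token s t (Suc n)) = Target"

definition mover_loses ::
    "(vertex \<Rightarrow> nat) \<Rightarrow> (vertex \<Rightarrow> edge_label) \<Rightarrow> (vertex \<Rightarrow> nat) \<Rightarrow> (vertex \<Rightarrow> nat) \<Rightarrow> nat \<Rightarrow> bool"
  where
  "mover_loses N L s t n \<longleftrightarrow>
     undecided N L s t n \<and> (N (token s t n) = 0 \<or> L (token s t (Suc n)) = Trap)"

definition first_player_wins_play ::
    "(vertex \<Rightarrow> nat) \<Rightarrow> (vertex \<Rightarrow> edge_label) \<Rightarrow> (vertex \<Rightarrow> nat) \<Rightarrow> (vertex \<Rightarrow> nat) \<Rightarrow> bool" where
  "first_player_wins_play N L s t \<longleftrightarrow>
     (\<exists>n. even n \<and> mover_wins N L s t n \<or> odd n \<and> mover_loses N L s t n)"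

definition second_player_wins_play ::
    "(vertex \<Rightarrow> nat) \<Rightarrow> (vertex \<Rightarrow> edge_label) \<Rightarrow> (vertex \<Rightarrow> nat) \<Rightarrow> (vertex \<Rightarrow> nat) \<Rightarrow> bool" where
  "second_player_wins_play N L s t \<longleftrightarrow>
     (\<exists>n. odd n \<and> mover_wins N L s t n \<or> even n \<and> mover_loses N L s t n)"

definition game_won :: "(vertex \<Rightarrow> nat) \<Rightarrow> (vertex \<Rightarrow> edge_label) \<Rightarrow> bool" where
  "game_won N L \<longleftrightarrow>
     (\<exists>s. valid_strategy N s \<and> (\<forall>t. valid_strategy N t \<longrightarrow> first_player_wins_play N L s t))"

definition game_lost :: "(vertex \<Rightarrow> nat) \<Rightarrow> (vertex \<Rightarrow> edge_label) \<Rightarrow> bool" where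
  "game_lost N L \<longleftrightarrow>
     (\<exists>t. valid_strategy N t \<and> (\<forall>s. valid_strategy N s \<longrightarrow> second_player_wins_play N L s t))"

definition game_drawn :: "(vertex \<Rightarrow> nat) \<Rightarrow> (vertex \<Rightarrow> edge_label) \<Rightarrow> bool" where
  "game_drawn N L \<longleftrightarrow> \<not> game_won N L \<and> \<not> game_lost N L"

definition draw_event ::
    "nat pmf \<Rightarrow> real \<Rightarrow> real \<Rightarrow> ((vertex \<Rightarrow> nat) \<times> (vertex \<Rightarrow> edge_label)) set" where
  "draw_event \<nu> p q = {(N, L) \<in> space (percolation_measure \<nu> p q). game_drawn N L}"

end

theory Submission
  imports Defs
begin

text \<open>
  Let \<open>l\<^sub>n\<close> be the probability that the first player loses within \<open>n\<close> rounds and \<open>u\<^sub>n\<close> the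
  probability that she does not win within \<open>n\<close> rounds.  Independence of the subtrees gives
  \<open>l\<^sub>n\<^sub>+\<^sub>1 = g u\<^sub>n\<close> and \<open>u\<^sub>n\<^sub>+\<^sub>1 = g l\<^sub>n\<close> with \<open>g x = (a - b x)\<^sup>d\<close>, \<open>a = 1 - \<pi> q\<close>,
  \<open>b = \<pi> (1 - p - q)\<close>, and by finite branching the probability of a draw is
  \<open>lim u\<^sub>n - lim l\<^sub>n\<close>.  The two limits form a 2-cycle of the decreasing map \<open>g\<close>.

  The stated inequality says that the fixed point of \<open>g\<close> has slope at least \<open>-1\<close>.  If it fails,
  the fixed point repels and separates the two limits.  Conversely, for a proper 2-cycle put
  \<open>s = a - b u < t = a - b l\<close>; then \<open>b (t\<^sup>d - s\<^sup>d) = t - s\<close> and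
  \<open>b (t\<^sup>d\<^sup>+\<^sup>1 - s\<^sup>d\<^sup>+\<^sup>1) = a (t - s)\<close>, and integrating the strict inequality
  \<open>(d - 1) x\<^sup>d - d c x\<^sup>d\<^sup>-\<^sup>1 + c\<^sup>d > 0\<close> (for \<open>x \<noteq> c\<close>) over \<open>[s, t]\<close> with \<open>c = a d / (d + 1)\<close>
  shows that the inequality fails.
\<close>

section \<open>Two-cycles of the recursion\<close>

text \<open>This is weighted AM-GM for \<open>d - 1\<close> copies of \<open>x ^ d\<close> and one
  of \<open>c ^ d\<close>. The induction rests on an exact recursion: the expression for
  \<open>n + 1\<close> is \<open>c\<close> times the one for \<open>n\<close> plus a nonnegative
  multiple of the square of \<open>x - c\<close>.\<close>

lemma weighted_power_AM_GM_strict: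
  fixes c x :: real
  assumes "d \<ge> 2" "0 \<le> x" "0 < c" "x \<noteq> c"
  shows "0 < (real d - 1) * x ^ d - real d * c * x ^ (d - 1) + c ^ d"
  using \<open>d \<ge> 2\<close>
proof (induction d rule: dec_induct)
  case base
  have "(x - c)\<^sup>2 > 0" using assms by simp
  then show ?case by (simp add: power2_eq_square algebra_simps)
next
  case (step n)
  then obtain m where n: "n = Suc m" by (cases n) auto
  have *: "(real (Suc n) - 1) * x ^ Suc n - real (Suc n) * c * x ^ (Suc n - 1) + c ^ Suc n
     = c * ((real n - 1) * x ^ n - real n * c * x ^ (n - 1) + c ^ n) + real n * x ^ (n - 1) * (x - c)\<^sup>2"
    unfolding n by (simp add: algebra_simps power2_eq_square)
  have "0 < c * ((real n - 1) * x ^ n - real n * c * x ^ (n - 1) + c ^ n)"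
    using step.IH assms by simp
  moreover have "0 \<le> real n * x ^ (n - 1) * (x - c)\<^sup>2"
    using assms by simp
  ultimately show ?case unfolding * by linarith
qed

text \<open>\<open>F\<close> is an antiderivative of the polynomial just bounded. On the nonnegative
  axis its derivative vanishes only at \<open>c\<close>, so an interval with \<open>c\<close> in its
  interior is split there.\<close>

lemma weighted_power_integral_strict_mono:
  fixes c s t :: real
  assumes "d \<ge> 2" "0 \<le> s" "s < t" "0 < c"
  defines "F \<equiv> \<lambda>x. (real d - 1) / (real d + 1) * x ^ (d + 1) - c * x ^ d + c ^ d * x"
  shows "F s < F t"
proof -
  let ?F' = "\<lambda>x. (real d - 1) * x ^ d - real d * c * x ^ (d - 1) + c ^ d"
  have der: "(F has_real_derivative ?F' x) (at x)" for x
    unfolding F_def by (rule derivative_eq_intros refl | simp add: add.commute)+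
  have cont: "continuous_on {x..y} F" for x y
    using der by (intro continuous_at_imp_continuous_on ballI) (rule DERIV_isCont)
  have pos: "0 < ?F' x" if "0 \<le> x" "x \<noteq> c" for x
    using weighted_power_AM_GM_strict that assms by blast
  have incr: "F x < F y" if "0 \<le> x" "x < y" "c \<notin> {x<..<y}" for x y
  proof (rule DERIV_pos_imp_increasing_open[OF \<open>x < y\<close> _ cont])
    fix z assume z: "x < z" "z < y"
    with that have "0 \<le> z" "z \<noteq> c" by auto
    with der pos show "\<exists>F'. (F has_real_derivative F') (at z) \<and> 0 < F'" by blast
  qed
  show ?thesis
  proof (cases "c \<in> {s<..<t}")
    case True
    then have "F s < F c" "F c < F t"
      using incr[of s c] incr[of c t] \<open>0 \<le> s\<close> by auto
    then show ?thesis by simp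
  next
    case False
    then show ?thesis using incr[OF \<open>0 \<le> s\<close> \<open>s < t\<close>] by simp
  qed
qed

text \<open>For \<open>c = a * d / (d + 1)\<close> one has \<open>a - c = a / (d + 1)\<close>.
  Hence, for positive \<open>a\<close>, comparing \<open>b * c ^ d\<close> with \<open>a - c\<close>
  amounts to comparing \<open>b * a ^ (d - 1)\<close> with the critical value; both directions of
  the criterion use this.\<close>

lemma scaled_power_identity:
  fixes a b :: real
  assumes "d > 0"
  shows "b * (a * real d / (real d + 1)) ^ d
    = a / (real d + 1) * (b * a ^ (d - 1) * (real d ^ d / (real d + 1) ^ (d - 1)))"
proof -
  obtain m where "d = Suc m" using assms by (cases d) auto
  then show ?thesis by (simp add: power_divide power_mult_distrib)
qed

text \<open>The map \<open>y \<mapsto> a - b * y ^ d\<close> is conjugate to the probability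
  recursion by \<open>y = a - b * x\<close>. On a two-cycle the increments of \<open>x ^ d\<close>
  and \<open>x ^ (d + 1)\<close> over \<open>[s, t]\<close> are known multiples of
  \<open>t - s\<close>; cancelling that factor from the integrated inequality leaves a relation
  between \<open>a\<close>, \<open>b\<close> and \<open>d\<close> alone.\<close>

lemma no_two_cycle:
  fixes a b s t :: real
  assumes d: "d \<ge> 2" and "0 < a" "0 < b" "0 \<le> s" "s < t"
    and s: "s = a - b * t ^ d" and t: "t = a - b * s ^ d"
  shows "b * a ^ (d - 1) > (real d + 1) ^ (d - 1) / real d ^ d"
proof -
  \<comment> \<open>The fixed point of \<open>y \<mapsto> a - b y\<^sup>d\<close> is neutral exactly when it equals \<open>c\<close>.\<close>
  define c where "c = a * real d / (real d + 1)"
  have c: "0 < c" unfolding c_def using \<open>0 < a\<close> d by simp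
  have bt: "b * t ^ d = a - s" and bs: "b * s ^ d = a - t"
    using s t by linarith+
  then have e1: "b * (t ^ d - s ^ d) = t - s"
    by (simp add: right_diff_distrib)
  have e2: "b * (t ^ (d + 1) - s ^ (d + 1)) = a * (t - s)"
  proof -
    have "b * (t ^ (d + 1) - s ^ (d + 1)) = t * (b * t ^ d) - s * (b * s ^ d)"
      by (simp add: algebra_simps)
    also have "\<dots> = t * (a - s) - s * (a - t)"
      unfolding bt bs ..
    finally show ?thesis by (simp add: algebra_simps)
  qed
  have "0 < b * (((real d - 1) / (real d + 1) * t ^ (d + 1) - c * t ^ d + c ^ d * t)
     - ((real d - 1) / (real d + 1) * s ^ (d + 1) - c * s ^ d + c ^ d * s))"
    using weighted_power_integral_strict_mono[OF d \<open>0 \<le> s\<close> \<open>s < t\<close> c] \<open>0 < b\<close> by simp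
  also have "\<dots> = (real d - 1) / (real d + 1) * (b * (t ^ (d + 1) - s ^ (d + 1)))
      - c * (b * (t ^ d - s ^ d)) + b * c ^ d * (t - s)"
    by (simp add: algebra_simps)
  also have "\<dots> = (t - s) * ((real d - 1) / (real d + 1) * a - c + b * c ^ d)"
    unfolding e1 e2 by (simp add: algebra_simps)
  finally have "0 < (real d - 1) / (real d + 1) * a - c + b * c ^ d"
    using \<open>s < t\<close> by (simp add: zero_less_mult_iff)
  moreover have "(real d - 1) / (real d + 1) * a - c = - (a / (real d + 1))"
    unfolding c_def by (simp add: divide_simps) (simp add: algebra_simps)
  ultimately have "a / (real d + 1) < b * c ^ d"
    by linarith
  also have "\<dots> = a / (real d + 1) * (b * a ^ (d - 1) * (real d ^ d / (real d + 1) ^ (d - 1)))"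
    unfolding c_def using d by (intro scaled_power_identity) simp
  finally have "a / (real d + 1) * 1
      < a / (real d + 1) * (b * a ^ (d - 1) * (real d ^ d / (real d + 1) ^ (d - 1)))"
    by simp
  then have "1 < b * a ^ (d - 1) * (real d ^ d / (real d + 1) ^ (d - 1))"
    by (rule mult_left_less_imp_less) (use \<open>0 < a\<close> in simp)
  then show ?thesis
    using d by (simp add: field_simps)
qed

text \<open>The point \<open>x\<close> serves as a barrier: \<open>g\<close> composed with itself is
  increasing on the unit interval, so its iterates started below \<open>x\<close> stay below
  \<open>x\<close> and cannot converge to \<open>x0\<close>.\<close>

lemma repelling_fixed_point:
  fixes a b :: real
  assumes d: "d \<ge> 2" and "0 < b" "b \<le> a" "a \<le> 1"
    and large: "b * a ^ (d - 1) > (real d + 1) ^ (d - 1) / real d ^ d"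
  defines "g \<equiv> \<lambda>x. (a - b * x) ^ d"
  obtains x0 x where "0 < x" "x < x0" "x0 \<le> 1" "g x0 = x0" "g (g x) < x"
proof -
  have "0 < a" using assms by simp
  have "\<exists>x\<ge>0. x \<le> 1 \<and> x - g x = 0"
  proof (rule IVT')
    show "0 - g 0 \<le> 0" using \<open>0 < a\<close> by (simp add: g_def)
    show "0 \<le> 1 - g 1" using assms by (simp add: g_def power_le_one)
    show "continuous_on {0..1} (\<lambda>x. x - g x)" unfolding g_def by (intro continuous_intros)
  qed simp
  then obtain x0 where x0: "0 \<le> x0" "x0 \<le> 1" "g x0 = x0" by auto
  \<comment> \<open>In this coordinate the fixed-point equation is \<open>y = a - b * y ^ d\<close>,
    whose solution is compared with the neutral value \<open>a * d / (d + 1)\<close>.\<close>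
  define y where "y = a - b * x0"
  have "b * x0 \<le> b" using x0 \<open>0 < b\<close> by (simp add: mult_left_le)
  then have "y \<ge> 0" unfolding y_def using assms by linarith
  have y: "y = a - b * y ^ d" using x0(3) unfolding g_def y_def by simp
  have "y \<noteq> 0" using y d \<open>0 < a\<close> by (auto simp: power_0_left)
  with \<open>y \<ge> 0\<close> have "y > 0" by simp
  have x0y: "x0 = y ^ d" using x0(3) unfolding g_def y_def by simp
  \<comment> \<open>Otherwise \<open>b * y ^ d\<close> would exceed \<open>a / (d + 1)\<close> by
    monotonicity, and \<open>y + b * y ^ d\<close> would exceed \<open>a\<close>.\<close>
  have "y < a * real d / (real d + 1)"
  proof (rule ccontr)
    assume "\<not> ?thesis"
    then have ge: "a * real d / (real d + 1) \<le> y" by simp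
    have "1 < b * a ^ (d - 1) * (real d ^ d / (real d + 1) ^ (d - 1))"
      using large d by (simp add: field_simps)
    then have "a / (real d + 1) * 1
        < a / (real d + 1) * (b * a ^ (d - 1) * (real d ^ d / (real d + 1) ^ (d - 1)))"
      using \<open>0 < a\<close> by (intro mult_strict_left_mono) auto
    also have "\<dots> = b * (a * real d / (real d + 1)) ^ d"
      using d by (intro scaled_power_identity[symmetric]) simp
    also have "\<dots> \<le> b * y ^ d"
      using ge \<open>0 < b\<close> \<open>0 < a\<close> by (intro mult_left_mono power_mono) auto
    finally have "a / (real d + 1) < a - y" using y by simp
    moreover have "a / (real d + 1) + a * real d / (real d + 1) = a"
      by (simp add: divide_simps) (simp add: algebra_simps)
    ultimately show False using ge by linarith
  qed
  \<comment> \<open>With \<open>a - y = b * y ^ d\<close> the bound on \<open>y\<close> turns into a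
    lower bound for the absolute slope of \<open>g\<close> at \<open>x0\<close>.\<close>
  then have "y < real d * (a - y)"
    by (simp add: field_simps)
  also have "a - y = b * y ^ d"
    using y by linarith
  also have "real d * (b * y ^ d) = real d * b * y ^ (d - 1) * y"
    using d by (cases d) auto
  finally have slope: "1 < real d * b * y ^ (d - 1)"
    using \<open>y > 0\<close> by simp
  define D where "D = real d * b * y ^ (d - 1)"
  have der: "(g has_real_derivative - D) (at x0)"
    unfolding g_def D_def y_def
    by (rule derivative_eq_intros refl | simp)+
  \<comment> \<open>The slope of \<open>g\<close> composed with itself at \<open>x0\<close> is
    \<open>D * D > 1\<close>, so \<open>g (g x) - x\<close>, which is zero at \<open>x0\<close>, is
    negative just to the left.\<close>
  have "((\<lambda>x. g (g x) - x) has_real_derivative (- D) * (- D) - 1) (at x0)"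
  proof (intro DERIV_diff DERIV_ident)
    show "((\<lambda>x. g (g x)) has_real_derivative (- D) * (- D)) (at x0)"
      using DERIV_chain2[of g "- D" g x0 "- D"] der x0(3) by simp
  qed
  moreover have "(- D) * (- D) - 1 > 0"
    using slope unfolding D_def[symmetric] by (simp add: less_1_mult)
  ultimately obtain e where e: "e > 0"
      "\<And>h. 0 < h \<Longrightarrow> h < e \<Longrightarrow> g (g (x0 - h)) - (x0 - h) < g (g x0) - x0"
    using DERIV_pos_inc_left by blast
  have "x0 > 0" using x0y \<open>y > 0\<close> by simp
  define h where "h = min e x0 / 2"
  have h: "0 < h" "h < e" "h < x0"
    unfolding h_def using \<open>x0 > 0\<close> \<open>e > 0\<close> by auto
  show ?thesis
  proof (rule that[of "x0 - h" x0])
    show "g (g (x0 - h)) < x0 - h"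
      using e(2)[OF h(1,2)] x0(3) by simp
  qed (use h x0 in auto)
qed

lemma alternating_iteration_limits_eq_iff:
  fixes a b :: real and l u :: "nat \<Rightarrow> real"
  assumes d: "d \<ge> 2" and "0 < b" "b \<le> a" "a \<le> 1"
    and l0: "l 0 = 0" and u0: "u 0 = 1"
    and lSuc: "\<And>n. l (Suc n) = (a - b * u n) ^ d" and uSuc: "\<And>n. u (Suc n) = (a - b * l n) ^ d"
    and bounds: "\<And>n. l n \<in> {0..1}" "\<And>n. u n \<in> {0..1}" and "incseq l"
    and l: "l \<longlonglongrightarrow> l'" and u: "u \<longlonglongrightarrow> u'" and "l' \<le> u'"
  shows "u' = l' \<longleftrightarrow> b * a ^ (d - 1) \<le> (real d + 1) ^ (d - 1) / real d ^ d"
proof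
  assume *: "b * a ^ (d - 1) \<le> (real d + 1) ^ (d - 1) / real d ^ d"
  have "(\<lambda>n. (a - b * u n) ^ d) \<longlonglongrightarrow> (a - b * u') ^ d"
    "(\<lambda>n. (a - b * l n) ^ d) \<longlonglongrightarrow> (a - b * l') ^ d"
    using l u by (auto intro!: tendsto_intros)
  moreover have "(\<lambda>n. l (Suc n)) \<longlonglongrightarrow> l'" "(\<lambda>n. u (Suc n)) \<longlonglongrightarrow> u'"
    using l u by (auto intro: LIMSEQ_Suc)
  ultimately have cyc: "l' = (a - b * u') ^ d" "u' = (a - b * l') ^ d"
    unfolding lSuc uSuc using LIMSEQ_unique by blast+
  have "u' \<le> 1" using bounds(2) u by (intro LIMSEQ_le_const2[OF u]) auto
  then have "b * u' \<le> b" using \<open>0 < b\<close> by (simp add: mult_left_le)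
  then have "0 \<le> a - b * u'" using \<open>b \<le> a\<close> by linarith
  then have "\<not> a - b * u' < a - b * l'"
    using no_two_cycle[OF d, of a b "a - b * u'" "a - b * l'"] assms * cyc by force
  then show "u' = l'" using \<open>l' \<le> u'\<close> \<open>0 < b\<close> by simp
next
  assume "u' = l'"
  show "b * a ^ (d - 1) \<le> (real d + 1) ^ (d - 1) / real d ^ d"
  proof (rule ccontr)
    define g where "g = (\<lambda>x. (a - b * x) ^ d)"
    assume "\<not> ?thesis"
    then obtain x0 x where x: "0 < x" "x < x0" "x0 \<le> 1" "g x0 = x0" "g (g x) < x"
      using repelling_fixed_point[OF d \<open>0 < b\<close> \<open>b \<le> a\<close> \<open>a \<le> 1\<close>] unfolding g_def by (metis not_le)
    \<comment> \<open>The bound \<open>z \<le> 1\<close> keeps \<open>a - b * z\<close> nonnegative,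
      as monotonicity of the power requires.\<close>
    have anti: "g z \<le> g y" if "y \<le> z" "z \<le> 1" for y z
    proof -
      have "b * z \<le> b" "b * y \<le> b * z"
        using \<open>0 < b\<close> that by (simp_all add: mult_left_le)
      then show ?thesis
        unfolding g_def using \<open>b \<le> a\<close> by (intro power_mono) auto
    qed
    \<comment> \<open>The decreasing map \<open>g\<close> exchanges the two sides of its fixed
      point, so \<open>x0\<close> always separates the two sequences.\<close>
    have "l n \<le> x0 \<and> x0 \<le> u n" for n
    proof (induction n)
      case (Suc n)
      have "g (u n) \<le> g x0" "g x0 \<le> g (l n)"
        using Suc bounds(2)[of n] x anti[of x0 "u n"] anti[of "l n" x0] by auto
      then show ?case using x(4) unfolding lSuc uSuc g_def by simp
    qed (use l0 u0 x in auto)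
    then have "x0 \<le> u'" by (intro LIMSEQ_le_const[OF u]) auto
    have g1: "g y \<le> 1" if "0 \<le> y" "y \<le> 1" for y
    proof -
      have "b * y \<le> b" "0 \<le> b * y" using that \<open>0 < b\<close> by (simp_all add: mult_left_le)
      then have "0 \<le> a - b * y" "a - b * y \<le> 1" using \<open>b \<le> a\<close> \<open>a \<le> 1\<close> by linarith+
      then show ?thesis unfolding g_def by (rule power_le_one)
    qed
    \<comment> \<open>Two steps of the alternating recursion apply \<open>g\<close> twice to
      \<open>l\<close>, which preserves the barrier along even indices; monotonicity of
      \<open>l\<close> then covers the odd ones.\<close>
    have l2: "l (2 * n) \<le> x" for n
    proof (induction n)
      case (Suc n)
      have "l (2 * Suc n) = g (g (l (2 * n)))"
        using lSuc[of "Suc (2 * n)"] uSuc[of "2 * n"] unfolding g_def by simp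
      also have "\<dots> \<le> g (g x)"
        using Suc bounds(1)[of "2 * n"] x g1 by (intro anti) auto
      finally show ?case using x by simp
    qed (use l0 x in auto)
    have "l n \<le> x" for n
      using incseqD[OF \<open>incseq l\<close>, of n "2 * n"] l2[of n] by simp
    then have "l' \<le> x" by (intro LIMSEQ_le_const2[OF l]) auto
    with \<open>x0 \<le> u'\<close> \<open>u' = l'\<close> x show False by simp
  qed
qed

section \<open>Winning within finitely many rounds\<close>

text \<open>Both predicates take the viewpoint of the player to move at \<open>v\<close>. At rank 0
  nothing is decided; at a leaf the universal condition is vacuous, so the mover loses there from
  rank 1 on.\<close>

fun win_within :: "(vertex \<Rightarrow> nat) \<Rightarrow> (vertex \<Rightarrow> edge_label) \<Rightarrow> nat \<Rightarrow> vertex \<Rightarrow> bool"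
  and lose_within :: "(vertex \<Rightarrow> nat) \<Rightarrow> (vertex \<Rightarrow> edge_label) \<Rightarrow> nat \<Rightarrow> vertex \<Rightarrow> bool" where
  "win_within N L 0 v \<longleftrightarrow> False"
| "lose_within N L 0 v \<longleftrightarrow> False"
| "win_within N L (Suc n) v \<longleftrightarrow>
     (\<exists>i<N v. L (v @ [i]) = Target \<or> L (v @ [i]) = Safe \<and> lose_within N L n (v @ [i]))"
| "lose_within N L (Suc n) v \<longleftrightarrow>
     (\<forall>i<N v. L (v @ [i]) = Trap \<or> L (v @ [i]) = Safe \<and> win_within N L n (v @ [i]))"

lemma within_mono_Suc:
  "(win_within N L n v \<longrightarrow> win_within N L (Suc n) v) \<and>
   (lose_within N L n v \<longrightarrow> lose_within N L (Suc n) v)"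
proof (induction n arbitrary: v)
  case (Suc n)
  then show ?case
    by (simp only: win_within.simps lose_within.simps) blast
qed simp

lemma win_within_mono:
  assumes "win_within N L m v" "m \<le> n"
  shows "win_within N L n v"
  using lift_Suc_mono_le[of "\<lambda>n. win_within N L n v", OF _ assms(2)] within_mono_Suc assms(1)
  by (simp add: le_bool_def)

lemma lose_within_mono:
  assumes "lose_within N L m v" "m \<le> n"
  shows "lose_within N L n v"
  using lift_Suc_mono_le[of "\<lambda>n. lose_within N L n v", OF _ assms(2)] within_mono_Suc assms(1)
  by (simp add: le_bool_def)

lemma not_win_and_lose_within: "\<not> (win_within N L n v \<and> lose_within N L n v)"
proof (induction n arbitrary: v)
  case (Suc n)
  show ?case
  proof
    assume *: "win_within N L (Suc n) v \<and> lose_within N L (Suc n) v"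
    then obtain i where i: "i < N v"
        "L (v @ [i]) = Target \<or> L (v @ [i]) = Safe \<and> lose_within N L n (v @ [i])"
      by auto
    with * have "L (v @ [i]) = Trap \<or> L (v @ [i]) = Safe \<and> win_within N L n (v @ [i])"
      by simp
    with i(2) Suc.IH[of "v @ [i]"] show False by auto
  qed
qed simp

lemma win_imp_not_lose: "win_within N L m v \<Longrightarrow> \<not> lose_within N L n v"
  using win_within_mono[of N L m v "max m n"] lose_within_mono[of N L n v "max m n"]
    not_win_and_lose_within[of N L "max m n" v] by linarith

text \<open>Asking merely for a lost child would allow a player to pass from won position to won
  position forever. Tying the move to the least rank of \<open>v\<close> forces the rank down with
  every move.\<close>

definition winning_move ::
    "(vertex \<Rightarrow> nat) \<Rightarrow> (vertex \<Rightarrow> edge_label) \<Rightarrow> vertex \<Rightarrow> nat \<Rightarrow> bool" where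
  "winning_move N L v i \<longleftrightarrow> i < N v \<and> (L (v @ [i]) = Target \<or> L (v @ [i]) = Safe \<and>
     lose_within N L ((LEAST n. win_within N L n v) - 1) (v @ [i]))"

definition nonlosing_move ::
    "(vertex \<Rightarrow> nat) \<Rightarrow> (vertex \<Rightarrow> edge_label) \<Rightarrow> vertex \<Rightarrow> nat \<Rightarrow> bool" where
  "nonlosing_move N L v i \<longleftrightarrow> i < N v \<and> (L (v @ [i]) = Target \<or> L (v @ [i]) = Safe \<and>
     (\<forall>n. \<not> win_within N L n (v @ [i])))"

lemma winning_imp_nonlosing_move: "winning_move N L v i \<Longrightarrow> nonlosing_move N L v i"
  unfolding winning_move_def nonlosing_move_def by (metis win_imp_not_lose)

lemma ex_winning_move:
  assumes "win_within N L k v"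
  shows "\<exists>i. winning_move N L v i" and "(LEAST n. win_within N L n v) - 1 < k"
proof -
  let ?m = "LEAST n. win_within N L n v"
  have m: "win_within N L ?m v" "?m \<le> k" 
    using assms by (auto intro: LeastI Least_le)
  then have "?m > 0"
    using win_within.simps(1) by (metis gr0I)
  with m show "?m - 1 < k" by linarith
  have "win_within N L (Suc (?m - 1)) v"
    using m \<open>?m > 0\<close> by simp
  then show "\<exists>i. winning_move N L v i"
    unfolding winning_move_def win_within.simps by blast
qed

text \<open>By finite branching the ranks of the children are bounded.\<close>

lemma ex_nonlosing_move:
  assumes "\<forall>n. \<not> lose_within N L n v"
  shows "\<exists>i. nonlosing_move N L v i"
proof (rule ccontr)
  assume "\<nexists>i. nonlosing_move N L v i"
  then have "\<forall>i<N v. L (v @ [i]) = Trap \<or> L (v @ [i]) = Safe \<and> (\<exists>n. win_within N L n (v @ [i]))"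
    unfolding nonlosing_move_def by (metis (no_types, lifting) edge_label.exhaust)
  then have "\<exists>f. \<forall>i<N v. L (v @ [i]) = Trap \<or> L (v @ [i]) = Safe \<and> win_within N L (f i) (v @ [i])"
    by (intro choice) blast
  then obtain f where f: "L (v @ [i]) = Trap \<or> L (v @ [i]) = Safe \<and> win_within N L (f i) (v @ [i])"
    if "i < N v" for i
    by blast
  have "f i \<le> Max (f ` {..<N v})" if "i < N v" for i
    using that by auto
  then have "lose_within N L (Suc (Max (f ` {..<N v}))) v"
    using f win_within_mono by (simp only: lose_within.simps) blast
  with assms show False by blast
qed

text \<open>A single positional strategy serves both players and both goals: lowering the rank from
  a won position, and otherwise never handing the opponent a won position. The default 0 is legal at
  every vertex that has a child.\<close>

definition optimal_strategy :: "(vertex \<Rightarrow> nat) \<Rightarrow> (vertex \<Rightarrow> edge_label) \<Rightarrow> vertex \<Rightarrow> nat" where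
  "optimal_strategy N L v =
     (if \<exists>i. winning_move N L v i then SOME i. winning_move N L v i
      else if \<exists>i. nonlosing_move N L v i then SOME i. nonlosing_move N L v i else 0)"

lemma optimal_strategy_winning_move:
  assumes "\<exists>i. winning_move N L v i"
  shows "winning_move N L v (optimal_strategy N L v)"
  unfolding optimal_strategy_def if_P[OF assms] using assms by (rule someI_ex)

lemma optimal_strategy_winning:
  "win_within N L k v \<Longrightarrow> winning_move N L v (optimal_strategy N L v)"
  by (rule optimal_strategy_winning_move[OF ex_winning_move(1)])

lemma optimal_strategy_nonlosing_move:
  assumes "\<exists>i. nonlosing_move N L v i"
  shows "nonlosing_move N L v (optimal_strategy N L v)"
proof (cases "\<exists>i. winning_move N L v i")
  case True
  then show ?thesis
    by (rule winning_imp_nonlosing_move[OF optimal_strategy_winning_move])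
next
  case False
  show ?thesis
    unfolding optimal_strategy_def if_not_P[OF False] if_P[OF assms]
    using assms by (rule someI_ex)
qed

lemma optimal_strategy_nonlosing:
  "\<forall>n. \<not> lose_within N L n v \<Longrightarrow> nonlosing_move N L v (optimal_strategy N L v)"
  by (rule optimal_strategy_nonlosing_move[OF ex_nonlosing_move])

lemma valid_optimal_strategy: "valid_strategy N (optimal_strategy N L)"
  unfolding valid_strategy_def
proof (intro ballI impI)
  fix v assume "N v > 0"
  show "optimal_strategy N L v < N v"
  proof (cases "\<exists>i. nonlosing_move N L v i")
    case True
    from optimal_strategy_nonlosing_move[OF this] show ?thesis
      unfolding nonlosing_move_def by simp
  next
    case False
    with winning_imp_nonlosing_move have "\<nexists>i. winning_move N L v i"
      by blast
    then show ?thesis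
      unfolding optimal_strategy_def if_not_P[OF False] using \<open>N v > 0\<close>
      by (simp only: if_False)
  qed
qed

text \<open>\<open>e\<close> is true for the first player and false for the second.\<close>

definition player_wins :: "bool \<Rightarrow> (vertex \<Rightarrow> nat) \<Rightarrow> (vertex \<Rightarrow> edge_label) \<Rightarrow>
    (vertex \<Rightarrow> nat) \<Rightarrow> (vertex \<Rightarrow> nat) \<Rightarrow> bool" where
  "player_wins e N L s t \<longleftrightarrow>
     (\<exists>n. even n = e \<and> mover_wins N L s t n \<or> even n \<noteq> e \<and> mover_loses N L s t n)"

section \<open>Plays in which one player follows the optimal strategy\<close>

lemma undecided_Suc: "undecided N L s t (Suc n) \<longleftrightarrow>
    undecided N L s t n \<and> N (token s t n) > 0 \<and> L (token s t (Suc n)) = Safe"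
  unfolding undecided_def All_less_Suc by blast

lemma token_Suc_legal:
  assumes "valid_strategy N s" "valid_strategy N t" "token s t n \<in> gw_tree N" "N (token s t n) > 0"
  obtains i where "i < N (token s t n)" "token s t (Suc n) = token s t n @ [i]"
    "token s t (Suc n) \<in> gw_tree N"
proof -
  let ?i = "(if even n then s else t) (token s t n)"
  have "?i < N (token s t n)"
    using assms unfolding valid_strategy_def by simp
  with assms(3) show ?thesis
    by (intro that[of ?i]) (auto intro: gw_tree.child)
qed

text \<open>Past the end of a play \<open>token\<close> may leave the tree, so legality is available
  only while the play is undecided.\<close>

lemma undecided_token_in_tree:
  assumes "valid_strategy N s" "valid_strategy N t"
  shows "undecided N L s t n \<Longrightarrow> token s t n \<in> gw_tree N"
proof (induction n)
  case (Suc n)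
  then have "token s t n \<in> gw_tree N" "N (token s t n) > 0"
    unfolding undecided_Suc by auto
  from token_Suc_legal[OF assms this] show ?case .
qed (simp add: gw_tree.root)

text \<open>The rank is the termination measure. The induction is strong because a move of the
  optimal player leads to one less than the least rank, which may lie far below
  \<open>k\<close>.\<close>

lemma optimal_strategy_forces_win:
  assumes valid: "valid_strategy N s" "valid_strategy N t"
    and opt: "(if e then s else t) = optimal_strategy N L"
  shows "undecided N L s t n \<Longrightarrow>
    (if even n = e then win_within N L k (token s t n) else lose_within N L k (token s t n)) \<Longrightarrow>
    player_wins e N L s t"
proof (induction k arbitrary: n rule: less_induct)
  case (less k)
  let ?v = "token s t n"
  have tree: "?v \<in> gw_tree N"
    using undecided_token_in_tree[OF valid less.prems(1)] .
  show ?case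
  proof (cases "even n = e")
    case True
    then have win: "win_within N L k ?v" using less.prems by simp
    have tok: "token s t (Suc n) = ?v @ [optimal_strategy N L ?v]"
      using opt True by auto
    have move: "winning_move N L ?v (optimal_strategy N L ?v)"
      using optimal_strategy_winning[OF win] .
    show ?thesis
    proof (cases "L (token s t (Suc n)) = Target")
      case T: True
      then have "mover_wins N L s t n"
        using less.prems(1) move unfolding mover_wins_def winning_move_def by auto
      with True show ?thesis unfolding player_wins_def by blast
    next
      case False
      let ?m = "(LEAST n. win_within N L n ?v) - 1"
      have *: "L (token s t (Suc n)) = Safe" "lose_within N L ?m (token s t (Suc n))" "N ?v > 0"
        using False move unfolding tok winning_move_def by auto
      have "even (Suc n) \<noteq> e" using True by auto
      then show ?thesis
        using less.IH[OF ex_winning_move(2)[OF win], of "Suc n"] * less.prems(1)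
        unfolding undecided_Suc by argo
    qed
  next
    case False
    then have lose: "lose_within N L k ?v" using less.prems by simp
    then obtain k' where k: "k = Suc k'" by (cases k) auto
    show ?thesis
    proof (cases "N ?v = 0 \<or> L (token s t (Suc n)) = Trap")
      case True
      then have "mover_loses N L s t n"
        using less.prems(1) unfolding mover_loses_def by simp
      with False show ?thesis unfolding player_wins_def by blast
    next
      case nt: False
      then obtain i where i: "i < N ?v" "token s t (Suc n) = ?v @ [i]"
        using token_Suc_legal[OF valid tree] by blast
      have *: "L (token s t (Suc n)) = Safe" "win_within N L k' (token s t (Suc n))"
        using lose nt i unfolding k by auto
      have "even (Suc n) = e" using False by auto
      then show ?thesis
        using less.IH[of k' "Suc n"] * less.prems(1) nt
        unfolding undecided_Suc k by simp
    qed
  qed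
qed

text \<open>While the play is undecided, the optimal player is never to move in a lost position, nor
  the opponent in a won one. This invariant excludes a defeat but allows an infinite play.\<close>

lemma optimal_strategy_avoids_loss:
  assumes valid: "valid_strategy N s" "valid_strategy N t"
    and opt: "(if e then s else t) = optimal_strategy N L"
    and root: "if e then \<forall>k. \<not> lose_within N L k [] else \<forall>k. \<not> win_within N L k []"
  shows "\<not> player_wins (\<not> e) N L s t"
proof -
  have inv: "if even n = e then \<forall>k. \<not> lose_within N L k (token s t n)
      else \<forall>k. \<not> win_within N L k (token s t n)" if "undecided N L s t n" for n
    using that
  proof (induction n)
    case 0
    then show ?case using root by simp
  next
    case (Suc n)
    let ?v = "token s t n"
    have und: "undecided N L s t n" "N ?v > 0" "L (token s t (Suc n)) = Safe"
      using Suc.prems unfolding undecided_Suc by auto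
    have IH: "if even n = e then \<forall>k. \<not> lose_within N L k ?v else \<forall>k. \<not> win_within N L k ?v"
      using Suc.IH und(1) .
    show ?case
    proof (cases "even n = e")
      case True
      then have "nonlosing_move N L ?v (optimal_strategy N L ?v)"
        using IH optimal_strategy_nonlosing by simp
      moreover have "token s t (Suc n) = ?v @ [optimal_strategy N L ?v]"
        using opt True by auto
      ultimately have "\<forall>k. \<not> win_within N L k (token s t (Suc n))"
        using und unfolding nonlosing_move_def by auto
      moreover have "even (Suc n) \<noteq> e" using True by auto
      ultimately show ?thesis by argo
    next
      case False
      obtain i where i: "i < N ?v" "token s t (Suc n) = ?v @ [i]"
        using token_Suc_legal[OF valid undecided_token_in_tree[OF valid und(1)] und(2)] by blast
      \<comment> \<open>A safe move to a child that is lost at rank \<open>k\<close> for the optimal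
        player would make the opponent's position won at rank \<open>k + 1\<close>.\<close>
      have "\<not> win_within N L (Suc k) ?v" for k
        using IH False by presburger
      then have "\<forall>k. \<not> lose_within N L k (token s t (Suc n))"
        using i und(3) by auto
      moreover have "even (Suc n) = e" using False by auto
      ultimately show ?thesis by argo
    qed
  qed
  have "\<not> mover_wins N L s t n" if "even n \<noteq> e" for n
  proof
    assume "mover_wins N L s t n"
    then have *: "undecided N L s t n" "N (token s t n) > 0" "L (token s t (Suc n)) = Target"
      unfolding mover_wins_def by auto
    obtain i where i: "i < N (token s t n)" "token s t (Suc n) = token s t n @ [i]"
      using token_Suc_legal[OF valid undecided_token_in_tree[OF valid *(1)] *(2)] by blast
    then have "win_within N L (Suc 0) (token s t n)"
      using * by auto
    with inv[OF *(1)] that show False by presburger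
  qed
  moreover have "\<not> mover_loses N L s t n" if "even n = e" for n
  proof
    assume *: "mover_loses N L s t n"
    then have und: "undecided N L s t n"
      unfolding mover_loses_def by simp
    have "nonlosing_move N L (token s t n) (optimal_strategy N L (token s t n))"
      using inv[OF und] that optimal_strategy_nonlosing by presburger
    moreover have "token s t (Suc n) = token s t n @ [optimal_strategy N L (token s t n)]"
      using opt that by auto
    ultimately show False
      using * unfolding mover_loses_def nonlosing_move_def by auto
  qed
  ultimately show ?thesis
    unfolding player_wins_def by blast
qed

lemma first_player_wins_play_iff: "first_player_wins_play N L s t \<longleftrightarrow> player_wins True N L s t"
  and second_player_wins_play_iff: "second_player_wins_play N L s t \<longleftrightarrow> player_wins False N L s t"
  unfolding first_player_wins_play_def second_player_wins_play_def player_wins_def by simp_all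

text \<open>A finite rank is played out by \<open>optimal_strategy\<close>. In the other direction
  the given winning strategy meets \<open>optimal_strategy\<close>, which could not be beaten if the
  root had no finite winning rank.\<close>

lemma game_won_iff: "game_won N L \<longleftrightarrow> (\<exists>n. win_within N L n [])"
proof
  assume "\<exists>n. win_within N L n []"
  then obtain n where n: "win_within N L n []" ..
  have "player_wins True N L (optimal_strategy N L) t" if "valid_strategy N t" for t
    using optimal_strategy_forces_win[OF valid_optimal_strategy that, where e = True and L = L and n = 0 and k = n] n
    by (simp add: undecided_def)
  then show "game_won N L"
    unfolding game_won_def first_player_wins_play_iff using valid_optimal_strategy by blast
next
  assume "game_won N L"
  then obtain s where s: "valid_strategy N s"
      "player_wins True N L s (optimal_strategy N L)"
    unfolding game_won_def first_player_wins_play_iff using valid_optimal_strategy by blast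
  then show "\<exists>n. win_within N L n []"
    using optimal_strategy_avoids_loss[OF s(1) valid_optimal_strategy, where e = False and L = L] by auto
qed

lemma game_lost_iff: "game_lost N L \<longleftrightarrow> (\<exists>n. lose_within N L n [])"
proof
  assume "\<exists>n. lose_within N L n []"
  then obtain n where n: "lose_within N L n []" ..
  have "player_wins False N L s (optimal_strategy N L)" if "valid_strategy N s" for s
    using optimal_strategy_forces_win[OF that valid_optimal_strategy, where e = False and L = L and n = 0 and k = n] n
    by (simp add: undecided_def)
  then show "game_lost N L"
    unfolding game_lost_def second_player_wins_play_iff using valid_optimal_strategy by blast
next
  assume "game_lost N L"
  then obtain t where t: "valid_strategy N t"
      "player_wins False N L (optimal_strategy N L) t"
    unfolding game_lost_def second_player_wins_play_iff using valid_optimal_strategy by blast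
  then show "\<exists>n. lose_within N L n []"
    using optimal_strategy_avoids_loss[OF valid_optimal_strategy t(1), where e = True and L = L] by auto
qed

section \<open>Independence of the subtrees\<close>

instance edge_label :: countable
  by countable_datatype

lemma prob_space_percolation: "prob_space (percolation_measure \<nu> p q)"
  unfolding percolation_measure_def
  by (intro prob_space_pair prob_space_PiM) (simp_all add: prob_space_measure_pmf)

lemma space_percolation [simp]: "space (percolation_measure \<nu> p q) = UNIV"
  by (simp add: percolation_measure_def space_pair_measure space_PiM PiE_UNIV_domain)

lemma measurable_percolation_fst [measurable]:
  "(\<lambda>\<omega>. fst \<omega> v) \<in> measurable (percolation_measure \<nu> p q) (count_space UNIV)"
  unfolding percolation_measure_def by measurable

lemma measurable_percolation_snd [measurable]:
  "(\<lambda>\<omega>. snd \<omega> v) \<in> measurable (percolation_measure \<nu> p q) (count_space UNIV)"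
  unfolding percolation_measure_def by measurable

lemma measurable_within:
  "{\<omega>. win_within (fst \<omega>) (snd \<omega>) n v} \<in> sets (percolation_measure \<nu> p q) \<and>
   {\<omega>. lose_within (fst \<omega>) (snd \<omega>) n v} \<in> sets (percolation_measure \<nu> p q)"
proof (induction n arbitrary: v)
  case (Suc n)
  let ?M = "percolation_measure \<nu> p q"
  have [measurable]: "Measurable.pred ?M (\<lambda>\<omega>. win_within (fst \<omega>) (snd \<omega>) n w)"
    "Measurable.pred ?M (\<lambda>\<omega>. lose_within (fst \<omega>) (snd \<omega>) n w)" for w
    using Suc by (simp_all add: pred_def)
  have "Measurable.pred ?M (\<lambda>\<omega>. win_within (fst \<omega>) (snd \<omega>) (Suc n) v)"
    "Measurable.pred ?M (\<lambda>\<omega>. lose_within (fst \<omega>) (snd \<omega>) (Suc n) v)"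
    unfolding win_within.simps lose_within.simps by measurable
  then show ?case by (simp add: pred_def)
qed simp

lemma pred_win_within [measurable]:
    "Measurable.pred (percolation_measure \<nu> p q) (\<lambda>\<omega>. win_within (fst \<omega>) (snd \<omega>) n v)"
  and pred_lose_within [measurable]:
    "Measurable.pred (percolation_measure \<nu> p q) (\<lambda>\<omega>. lose_within (fst \<omega>) (snd \<omega>) n v)"
  using measurable_within by (simp_all add: pred_def)

text \<open>Provides the locality through which independence of disjoint blocks of words becomes
  independence of the games in different subtrees.\<close>

lemma within_cong:
  assumes "\<And>u. N (v @ u) = N' (v @ u)" "\<And>i u. L (v @ i # u) = L' (v @ i # u)"
  shows "(win_within N L n v \<longleftrightarrow> win_within N' L' n v) \<and>
    (lose_within N L n v \<longleftrightarrow> lose_within N' L' n v)"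
  using assms
proof (induction n arbitrary: v)
  case (Suc n)
  have "(win_within N L n (v @ [i]) \<longleftrightarrow> win_within N' L' n (v @ [i])) \<and>
    (lose_within N L n (v @ [i]) \<longleftrightarrow> lose_within N' L' n (v @ [i]))" for i
    using Suc.prems by (intro Suc.IH) (simp_all)
  moreover have "N v = N' v" using Suc.prems(1)[of "[]"] by simp
  moreover have "L (v @ [i]) = L' (v @ [i])" for i using Suc.prems(2)[of i "[]"] by simp
  ultimately show ?case by simp
qed simp

section \<open>Independence over words and branching at one vertex\<close>

lemma indep_vars_PiM_components:
  assumes "\<And>i. prob_space (M i)"
  shows "prob_space.indep_vars (PiM UNIV M) M (\<lambda>i f. f i) UNIV"
proof -
  interpret P: product_prob_space M UNIV
    by (rule product_prob_spaceI) (rule assms)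
  have prob: "prob_space (PiM UNIV M)"
    by (rule prob_space_PiM) (rule assms)
  have "distr (PiM UNIV M) (PiM UNIV M) (\<lambda>x. \<lambda>i\<in>UNIV. x i) = PiM UNIV M"
    by (simp add: restrict_UNIV distr_id)
  also have "\<dots> = PiM UNIV (\<lambda>i. distr (PiM UNIV M) (M i) (\<lambda>x. x i))"
    by (intro PiM_cong refl) (simp add: P.PiM_component)
  finally show ?thesis
    by (subst prob_space.indep_vars_iff_distr_eq_PiM[OF prob]) simp_all
qed

text \<open>The measure is a pair of infinite products, whereas the game needs count and label at
  each word as one variable. The joint law of these pairs is matched with the product of their laws
  on finite cylinders.\<close>

lemma indep_vars_pair_PiM_components:
  fixes P :: "'a :: countable pmf" and Q :: "'b :: countable pmf"
  defines "M \<equiv> (\<Pi>\<^sub>M i\<in>(UNIV :: 'i set). measure_pmf P) \<Otimes>\<^sub>M (\<Pi>\<^sub>M i\<in>(UNIV :: 'i set). measure_pmf Q)"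
  shows "prob_space.indep_vars M (\<lambda>_. count_space UNIV) (\<lambda>i \<omega>. (fst \<omega> i, snd \<omega> i)) UNIV"
proof -
  let ?A = "\<Pi>\<^sub>M i\<in>(UNIV :: 'i set). measure_pmf P" and ?B = "\<Pi>\<^sub>M i\<in>(UNIV :: 'i set). measure_pmf Q"
  let ?S = "count_space (UNIV :: ('a \<times> 'b) set)"
  let ?X = "\<lambda>i (\<omega> :: ('i \<Rightarrow> 'a) \<times> ('i \<Rightarrow> 'b)). (fst \<omega> i, snd \<omega> i)"
  interpret A: prob_space ?A by (intro prob_space_PiM) (simp add: prob_space_measure_pmf)
  interpret B: prob_space ?B by (intro prob_space_PiM) (simp add: prob_space_measure_pmf)
  interpret PB: product_prob_space "\<lambda>_. measure_pmf Q" "UNIV :: 'i set"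
    by (rule product_prob_spaceI) (simp add: prob_space_measure_pmf)
  interpret M: prob_space M unfolding M_def by (intro prob_space_pair) unfold_locales
  have space: "space M = UNIV" "space ?A = UNIV" "space ?B = UNIV"
    by (simp_all add: M_def space_pair_measure space_PiM PiE_UNIV_domain)
  have [measurable]: "?X i \<in> measurable M ?S" for i
  proof -
    have "?X i \<in> measurable M (count_space UNIV \<Otimes>\<^sub>M count_space UNIV)"
      unfolding M_def by measurable
    then show ?thesis by (simp add: pair_measure_countable)
  qed
  \<comment> \<open>With the first family fixed, the second contributes a product over
    \<open>J\<close>; independence of the first family then moves this product out of the
    integral.\<close>
  have cylinder: "emeasure M {\<omega>. \<forall>i\<in>J. ?X i \<omega> \<in> E i}
      = (\<Prod>i\<in>J. \<integral>\<^sup>+ f. emeasure (measure_pmf Q) {y. (f i, y) \<in> E i} \<partial>?A)"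
    if "finite J" for J :: "'i set" and E
  proof -
    have sets: "{\<omega>. \<forall>i\<in>J. ?X i \<omega> \<in> E i} \<in> sets M"
    proof -
      have "Measurable.pred M (\<lambda>\<omega>. \<forall>i\<in>J. ?X i \<omega> \<in> E i)"
        using \<open>finite J\<close> by measurable
      then show ?thesis by (simp add: pred_def space)
    qed
    have "emeasure M {\<omega>. \<forall>i\<in>J. ?X i \<omega> \<in> E i}
        = (\<integral>\<^sup>+ f. emeasure ?B (Pair f -` {\<omega>. \<forall>i\<in>J. ?X i \<omega> \<in> E i}) \<partial>?A)"
      using sets unfolding M_def by (rule B.emeasure_pair_measure_alt)
    also have "\<dots> = (\<integral>\<^sup>+ f. (\<Prod>i\<in>J. emeasure (measure_pmf Q) {y. (f i, y) \<in> E i}) \<partial>?A)"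
    proof (intro nn_integral_cong)
      fix f
      have "Pair f -` {\<omega>. \<forall>i\<in>J. ?X i \<omega> \<in> E i}
          = {g \<in> space ?B. \<forall>i\<in>J. g i \<in> {y. (f i, y) \<in> E i}}"
        by (auto simp: space)
      then show "emeasure ?B (Pair f -` {\<omega>. \<forall>i\<in>J. ?X i \<omega> \<in> E i})
          = (\<Prod>i\<in>J. emeasure (measure_pmf Q) {y. (f i, y) \<in> E i})"
        using PB.emeasure_PiM_Collect[of J "\<lambda>i. {y. (f i, y) \<in> E i}"] \<open>finite J\<close> by simp
    qed
    also have "\<dots> = (\<Prod>i\<in>J. \<integral>\<^sup>+ f. emeasure (measure_pmf Q) {y. (f i, y) \<in> E i} \<partial>?A)"
    proof (intro A.indep_vars_nn_integral \<open>finite J\<close>)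
      have "A.indep_vars (\<lambda>_. measure_pmf P) (\<lambda>i f. f i) J"
        by (rule A.indep_vars_subset[OF indep_vars_PiM_components]) (simp_all add: prob_space_measure_pmf)
      then show "A.indep_vars (\<lambda>_. borel) (\<lambda>i f. emeasure (measure_pmf Q) {y. (f i, y) \<in> E i}) J"
        by (rule A.indep_vars_compose2) simp
    qed simp
    finally show ?thesis .
  qed
  have "distr M (\<Pi>\<^sub>M i\<in>UNIV. ?S) (\<lambda>\<omega>. \<lambda>i\<in>UNIV. ?X i \<omega>) = (\<Pi>\<^sub>M i\<in>UNIV. distr M ?S (?X i))"
    (is "?L = ?R")
  proof (rule measure_eqI_PiM_infinite)
    show "sets ?L = sets (PiM UNIV (\<lambda>_. ?S))" "sets ?R = sets (PiM UNIV (\<lambda>_. ?S))"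
      by (simp, intro sets_PiM_cong) simp_all
    show "finite_measure ?L"
      by (intro prob_space.finite_measure M.prob_space_distr) simp
    fix E :: "'i \<Rightarrow> ('a \<times> 'b) set" and J :: "'i set" assume J: "finite J"
    let ?C = "prod_emb UNIV (\<lambda>_. ?S) J (Pi\<^sub>E J E)"
    interpret R: product_prob_space "\<lambda>i. distr M ?S (?X i)" UNIV
      by (intro product_prob_spaceI M.prob_space_distr) simp
    have C: "?C = {f. \<forall>i\<in>J. f i \<in> E i}"
      by (auto simp: prod_emb_def PiE_UNIV_domain PiE_iff)
    have "emeasure ?L ?C = emeasure M {\<omega>. \<forall>i\<in>J. ?X i \<omega> \<in> E i}"
    proof (subst emeasure_distr)
      show "?C \<in> sets (PiM UNIV (\<lambda>_. ?S))"
        using J by (intro sets_PiM_I) auto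
      show "(\<lambda>\<omega>. \<lambda>i\<in>UNIV. ?X i \<omega>) \<in> measurable M (\<Pi>\<^sub>M i\<in>UNIV. ?S)"
        by (intro measurable_restrict) simp
    qed (simp_all add: C space vimage_def restrict_UNIV)
    \<comment> \<open>Applied to singleton index sets, \<open>cylinder\<close> identifies each
      factor with the probability of one coordinate event.\<close>
    also have "\<dots> = (\<Prod>i\<in>J. emeasure M {\<omega>. ?X i \<omega> \<in> E i})"
      unfolding cylinder[OF J] using cylinder[of "{_}" E] by (intro prod.cong refl) simp
    also have "\<dots> = (\<Prod>i\<in>J. emeasure (distr M ?S (?X i)) (E i))"
      by (intro prod.cong refl) (simp add: emeasure_distr space vimage_def)
    also have "\<dots> = emeasure ?R (prod_emb UNIV (\<lambda>i. distr M ?S (?X i)) J (Pi\<^sub>E J E))"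
      using J by (subst R.emeasure_PiM_emb) auto
    also have "prod_emb UNIV (\<lambda>i. distr M ?S (?X i)) J (Pi\<^sub>E J E) = ?C"
      by (simp add: prod_emb_def)
    finally show "emeasure ?L ?C = emeasure ?R ?C" .
  qed
  then show ?thesis
    by (subst M.indep_vars_iff_distr_eq_PiM) simp_all
qed

lemma prob_child_count_and_label:
  "measure (percolation_measure \<nu> p q) {\<omega>. fst \<omega> v = k \<and> snd \<omega> v \<in> E}
    = pmf \<nu> k * measure_pmf.prob (edge_label_pmf p q) E"
proof -
  let ?A = "\<Pi>\<^sub>M v\<in>(UNIV :: vertex set). measure_pmf \<nu>"
    and ?B = "\<Pi>\<^sub>M v\<in>(UNIV :: vertex set). measure_pmf (edge_label_pmf p q)"
  interpret B': prob_space ?B by (intro prob_space_PiM) (simp add: prob_space_measure_pmf)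
  interpret A: product_prob_space "\<lambda>_. measure_pmf \<nu>" "UNIV :: vertex set"
    by (rule product_prob_spaceI) (simp add: prob_space_measure_pmf)
  interpret B: product_prob_space "\<lambda>_. measure_pmf (edge_label_pmf p q)" "UNIV :: vertex set"
    by (rule product_prob_spaceI) (simp add: prob_space_measure_pmf)
  have space: "space ?A = UNIV" "space ?B = UNIV"
    by (simp_all add: space_PiM PiE_UNIV_domain)
  have eq: "{\<omega>. fst \<omega> v = k \<and> snd \<omega> v \<in> E} = {f \<in> space ?A. f v \<in> {k}} \<times> {g \<in> space ?B. g v \<in> E}"
    by (auto simp: space)
  have "emeasure (percolation_measure \<nu> p q) {\<omega>. fst \<omega> v = k \<and> snd \<omega> v \<in> E}
      = emeasure ?A {f \<in> space ?A. f v \<in> {k}} * emeasure ?B {g \<in> space ?B. g v \<in> E}"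
    unfolding eq percolation_measure_def
    by (intro B'.emeasure_pair_measure_Times measurable_sets_Collect[where M = ?A] ) measurable
  also have "\<dots> = emeasure (measure_pmf \<nu>) {k} * emeasure (measure_pmf (edge_label_pmf p q)) E"
    by (subst A.emeasure_PiM_Collect_single, simp, simp, subst B.emeasure_PiM_Collect_single) simp_all
  also have "\<dots> = ennreal (pmf \<nu> k * measure_pmf.prob (edge_label_pmf p q) E)"
    by (simp add: emeasure_pmf_single measure_pmf.emeasure_eq_measure ennreal_mult' measure_pmf_single)
  finally show ?thesis
    by (simp add: measure_def)
qed

text \<open>For each possible number \<open>k\<close> of children, the first \<open>k\<close>
  subtree events are independent of each other and of the count and label at \<open>v\<close>. As
  counts and labels live on all words, \<open>B i\<close> makes sense beyond the actual number of
  children.\<close>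

lemma sums_prob_all_children:
  fixes B :: "nat \<Rightarrow> (vertex \<Rightarrow> nat) \<times> (vertex \<Rightarrow> edge_label) \<Rightarrow> bool"
  assumes M_def: "M = percolation_measure \<nu> p q"
    and meas [measurable]: "\<And>i. Measurable.pred M (B i)"
    and local: "\<And>i N L N' L'. (\<And>u. N (v @ i # u) = N' (v @ i # u)) \<Longrightarrow>
      (\<And>u. L (v @ i # u) = L' (v @ i # u)) \<Longrightarrow> B i (N, L) \<Longrightarrow> B i (N', L')"
    and prob: "\<And>i. measure M {\<omega>. B i \<omega>} = c"
  shows "(\<lambda>k. measure_pmf.prob (edge_label_pmf p q) E * (pmf \<nu> k * c ^ k)) sums
    measure M {\<omega>. snd \<omega> v \<in> E \<and> (\<forall>i<fst \<omega> v. B i \<omega>)}"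
proof -
  interpret M: prob_space M unfolding M_def by (rule prob_space_percolation)
  let ?S = "count_space (UNIV :: (nat \<times> edge_label) set)"
  let ?X = "\<lambda>w (\<omega> :: (vertex \<Rightarrow> nat) \<times> (vertex \<Rightarrow> edge_label)). (fst \<omega> w, snd \<omega> w)"
  \<comment> \<open>\<open>None\<close> stands for the word \<open>v\<close> itself and
    \<open>Some i\<close> for all words through child \<open>i\<close>; these blocks are
    disjoint.\<close>
  define K where "K j = (case j of None \<Rightarrow> {v} | Some i \<Rightarrow> range (\<lambda>u. v @ i # u))" for j
  have space [simp]: "space M = UNIV" unfolding M_def by simp
  have [measurable]: "(\<lambda>\<omega>. fst \<omega> v) \<in> measurable M (count_space UNIV)"
      "(\<lambda>\<omega>. snd \<omega> v) \<in> measurable M (count_space UNIV)"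
    unfolding M_def by measurable
  have "M.indep_vars (\<lambda>_. ?S) ?X UNIV"
    unfolding M_def percolation_measure_def by (rule indep_vars_pair_PiM_components)
  then have indep: "M.indep_vars (\<lambda>j. PiM (K j) (\<lambda>_. ?S)) (\<lambda>j \<omega>. restrict (\<lambda>w. ?X w \<omega>) (K j)) UNIV"
    by (rule M.indep_vars_restrict)
      (auto simp: disjoint_family_on_def K_def split: option.splits)
  \<comment> \<open>\<open>ext\<close> reads a function on a block as a realization again. Off the
    block its values come from \<open>undefined\<close>, which \<open>local\<close> makes
    irrelevant.\<close>
  define ext :: "(vertex \<Rightarrow> nat \<times> edge_label) \<Rightarrow> (vertex \<Rightarrow> nat) \<times> (vertex \<Rightarrow> edge_label)"
    where "ext h = (\<lambda>w. fst (h w), \<lambda>w. snd (h w))" for h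
  have ext_measurable: "ext \<in> measurable (PiM I (\<lambda>_. ?S)) M" for I
  proof -
    have coord: "(\<lambda>h. f (h w)) \<in> measurable (PiM I (\<lambda>_. ?S)) (count_space UNIV)"
      for f :: "nat \<times> edge_label \<Rightarrow> 'c" and w
    proof (cases "w \<in> I")
      case True
      then show ?thesis by measurable
    next
      case False
      have "(\<lambda>h. f (h w)) \<in> measurable (PiM I (\<lambda>_. ?S)) (count_space UNIV) \<longleftrightarrow>
          (\<lambda>h. f undefined) \<in> measurable (PiM I (\<lambda>_. ?S)) (count_space UNIV)"
        using False by (intro measurable_cong) (auto simp: space_PiM PiE_def extensional_def)
      then show ?thesis by simp
    qed
    show ?thesis
      unfolding ext_def M_def percolation_measure_def
      by (intro measurable_Pair measurable_PiM_single') (auto simp: coord space_PiM)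
  qed
  have ext_local: "B i (ext (restrict (\<lambda>w. ?X w \<omega>) (K (Some i)))) \<longleftrightarrow> B i \<omega>" for i \<omega>
  proof -
    have "fst (restrict (\<lambda>w. ?X w \<omega>) (K (Some i)) (v @ i # u)) = fst \<omega> (v @ i # u)"
      "snd (restrict (\<lambda>w. ?X w \<omega>) (K (Some i)) (v @ i # u)) = snd \<omega> (v @ i # u)" for u
      by (simp_all add: K_def)
    then show ?thesis
      unfolding ext_def
      using local[where i = i and N = "fst \<omega>" and L = "snd \<omega>"]
        local[where i = i and N' = "fst \<omega>" and L' = "snd \<omega>"]
      unfolding prod.collapse by (metis (no_types, lifting))
  qed
  have slice: "measure M {\<omega>. (fst \<omega> v = k \<and> snd \<omega> v \<in> E) \<and> (\<forall>i<k. B i \<omega>)}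
      = measure_pmf.prob (edge_label_pmf p q) E * (pmf \<nu> k * c ^ k)" for k
  proof -
    define Y where "Y j h = (case j of None \<Rightarrow> h v \<in> {k} \<times> E | Some i \<Rightarrow> B i (ext h))" for j h
    define Z where "Z j \<omega> = Y j (restrict (\<lambda>w. ?X w \<omega>) (K j))" for j \<omega>
    have Z: "Z None \<omega> \<longleftrightarrow> fst \<omega> v = k \<and> snd \<omega> v \<in> E" "Z (Some i) \<omega> \<longleftrightarrow> B i \<omega>" for i \<omega>
      using ext_local by (auto simp: Z_def Y_def K_def)
    have Z_event: "Z None -` {True} = {\<omega>. fst \<omega> v = k \<and> snd \<omega> v \<in> E}"
        "Z (Some i) -` {True} = {\<omega>. B i \<omega>}" for i
      using Z by auto
    have "M.indep_vars (\<lambda>_. count_space UNIV) Z UNIV"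
      unfolding Z_def using indep
    proof (rule M.indep_vars_compose2)
      fix j
      show "Y j \<in> measurable (PiM (K j) (\<lambda>_. ?S)) (count_space UNIV)"
      proof (cases j)
        case None
        have "(\<lambda>h. h v) \<in> measurable (PiM (K j) (\<lambda>_. ?S)) ?S"
          by (rule measurable_component_singleton) (simp add: None K_def)
        then have "(\<lambda>h. h v \<in> {k} \<times> E) \<in> measurable (PiM (K j) (\<lambda>_. ?S)) (count_space UNIV)"
          by (rule measurable_compose) simp
        then show ?thesis unfolding Y_def None option.case .
      next
        case (Some i)
        show ?thesis
          unfolding Y_def Some option.case by (rule measurable_compose[OF ext_measurable meas])
      qed
    qed
    then have "M.prob (\<Inter>j\<in>insert None (Some ` {..<k}). Z j -` {True} \<inter> space M)
        = (\<Prod>j\<in>insert None (Some ` {..<k}). M.prob (Z j -` {True} \<inter> space M))"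
      by (rule M.indep_varsD) auto
    also have "(\<Inter>j\<in>insert None (Some ` {..<k}). Z j -` {True} \<inter> space M)
        = {\<omega>. (fst \<omega> v = k \<and> snd \<omega> v \<in> E) \<and> (\<forall>i<k. B i \<omega>)}"
      using Z by auto
    also have "(\<Prod>j\<in>insert None (Some ` {..<k}). M.prob (Z j -` {True} \<inter> space M))
        = M.prob {\<omega>. fst \<omega> v = k \<and> snd \<omega> v \<in> E} * (\<Prod>i<k. M.prob {\<omega>. B i \<omega>})"
      by (subst prod.insert) (auto simp: prod.reindex Z_event)
    also have "\<dots> = measure_pmf.prob (edge_label_pmf p q) E * (pmf \<nu> k * c ^ k)"
      unfolding prob by (simp add: M_def prob_child_count_and_label)
    finally show ?thesis .
  qed
  have "(\<lambda>k. measure M {\<omega>. (fst \<omega> v = k \<and> snd \<omega> v \<in> E) \<and> (\<forall>i<k. B i \<omega>)}) sums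
      measure M (\<Union>k. {\<omega>. (fst \<omega> v = k \<and> snd \<omega> v \<in> E) \<and> (\<forall>i<k. B i \<omega>)})"
  proof (rule M.finite_measure_UNION)
    have "Measurable.pred M (\<lambda>\<omega>. (fst \<omega> v = k \<and> snd \<omega> v \<in> E) \<and> (\<forall>i<k. B i \<omega>))" for k
      by measurable
    then show "range (\<lambda>k. {\<omega>. (fst \<omega> v = k \<and> snd \<omega> v \<in> E) \<and> (\<forall>i<k. B i \<omega>)}) \<subseteq> sets M"
      by (auto simp: pred_def)
  qed (auto simp: disjoint_family_on_def)
  also have "(\<Union>k. {\<omega>. (fst \<omega> v = k \<and> snd \<omega> v \<in> E) \<and> (\<forall>i<k. B i \<omega>)})
      = {\<omega>. snd \<omega> v \<in> E \<and> (\<forall>i<fst \<omega> v. B i \<omega>)}"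
    by auto
  finally show ?thesis unfolding slice .
qed


text \<open>The series is the generating function of the binomial law at \<open>c\<close>, summed by
  the binomial theorem.\<close>

lemma prob_all_children_binomial:
  fixes B :: "nat \<Rightarrow> (vertex \<Rightarrow> nat) \<times> (vertex \<Rightarrow> edge_label) \<Rightarrow> bool"
  assumes M_def: "M = percolation_measure (binomial_pmf d \<pi>) p q"
    and \<pi>: "0 \<le> \<pi>" "\<pi> \<le> 1"
    and meas: "\<And>i. Measurable.pred M (B i)"
    and local: "\<And>i N L N' L'. (\<And>u. N (v @ i # u) = N' (v @ i # u)) \<Longrightarrow>
      (\<And>u. L (v @ i # u) = L' (v @ i # u)) \<Longrightarrow> B i (N, L) \<Longrightarrow> B i (N', L')"
    and prob: "\<And>i. measure M {\<omega>. B i \<omega>} = c"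
  shows "measure M {\<omega>. snd \<omega> v \<in> E \<and> (\<forall>i<fst \<omega> v. B i \<omega>)}
    = measure_pmf.prob (edge_label_pmf p q) E * (1 - \<pi> + \<pi> * c) ^ d"
proof -
  let ?f = "\<lambda>k. measure_pmf.prob (edge_label_pmf p q) E * (pmf (binomial_pmf d \<pi>) k * c ^ k)"
  have "?f sums measure M {\<omega>. snd \<omega> v \<in> E \<and> (\<forall>i<fst \<omega> v. B i \<omega>)}"
    using sums_prob_all_children[OF M_def meas local prob] .
  moreover have "?f sums (\<Sum>k\<le>d. ?f k)"
    by (rule sums_finite) (use \<pi> in \<open>auto simp: not_le\<close>)
  ultimately have "measure M {\<omega>. snd \<omega> v \<in> E \<and> (\<forall>i<fst \<omega> v. B i \<omega>)} = (\<Sum>k\<le>d. ?f k)"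
    by (rule sums_unique2)
  also have "\<dots> = measure_pmf.prob (edge_label_pmf p q) E *
      (\<Sum>k\<le>d. real (d choose k) * (\<pi> * c) ^ k * (1 - \<pi>) ^ (d - k))"
    unfolding sum_distrib_left using \<pi>
    by (intro sum.cong refl) (simp add: power_mult_distrib)
  also have "(\<Sum>k\<le>d. real (d choose k) * (\<pi> * c) ^ k * (1 - \<pi>) ^ (d - k)) = (\<pi> * c + (1 - \<pi>)) ^ d"
    by (rule binomial_ring[symmetric])
  finally show ?thesis by (simp add: add.commute)
qed

section \<open>Recursion for the losing and non-winning probabilities\<close>

lemma pmf_edge_label_pmf:
  assumes "p \<ge> 0" "q \<ge> 0" "p + q \<le> 1"
  shows "pmf (edge_label_pmf p q) Trap = p" "pmf (edge_label_pmf p q) Target = q"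
    "pmf (edge_label_pmf p q) Safe = 1 - p - q"
proof -
  have "pmf_of_list_wf [(Trap, p), (Target, q), (Safe, 1 - p - q)]"
    using assms by (intro pmf_of_list_wfI) auto
  then show "pmf (edge_label_pmf p q) Trap = p" "pmf (edge_label_pmf p q) Target = q"
      "pmf (edge_label_pmf p q) Safe = 1 - p - q"
    unfolding edge_label_pmf_def by (simp_all add: pmf_pmf_of_list)
qed

text \<open>A binomial count amounts to \<open>d\<close> potential children, each present with
  probability \<open>\<pi>\<close>. For \<open>a = 1 - \<pi> * q\<close> and
  \<open>b = \<pi> * (1 - p - q)\<close>, the factor \<open>a - b * x\<close> is the probability
  that one of them is absent, or reached by a trap, or reached by a safe edge without an event of
  probability \<open>x\<close> in its subtree.\<close>

fun lose_prob nonwin_prob :: "real \<Rightarrow> real \<Rightarrow> nat \<Rightarrow> nat \<Rightarrow> real" where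
  "lose_prob a b d 0 = 0"
| "nonwin_prob a b d 0 = 1"
| "lose_prob a b d (Suc n) = (a - b * nonwin_prob a b d n) ^ d"
| "nonwin_prob a b d (Suc n) = (a - b * lose_prob a b d n) ^ d"

text \<open>
  The label of the edge into \<open>v\<close> is carried along because the independence used in
  the step is between the pairs of child count and label at distinct words.
\<close>

lemma prob_lose_and_nonwin:
  fixes d :: nat and \<pi> p q :: real
  defines "M \<equiv> percolation_measure (binomial_pmf d \<pi>) p q"
    and "a \<equiv> 1 - \<pi> * q" and "b \<equiv> \<pi> * (1 - p - q)"
  assumes \<pi>: "0 \<le> \<pi>" "\<pi> \<le> 1" and pq: "p \<ge> 0" "q \<ge> 0" "p + q \<le> 1"
  shows "measure M {\<omega>. snd \<omega> v \<in> E \<and> lose_within (fst \<omega>) (snd \<omega>) n v}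
        = measure_pmf.prob (edge_label_pmf p q) E * lose_prob a b d n \<and>
      measure M {\<omega>. snd \<omega> v \<in> E \<and> \<not> win_within (fst \<omega>) (snd \<omega>) n v}
        = measure_pmf.prob (edge_label_pmf p q) E * nonwin_prob a b d n"
proof (induction n arbitrary: v E)
  case 0
  interpret M: prob_space M unfolding M_def by (rule prob_space_percolation)
  have "measure M UNIV = 1"
    using M.prob_space unfolding M_def by simp
  \<comment> \<open>A trivial condition on the children has probability 1, so the branching formula
    returns the law of the label alone.\<close>
  then have "measure M {\<omega>. snd \<omega> v \<in> E \<and> (\<forall>i<fst \<omega> v. True)}
      = measure_pmf.prob (edge_label_pmf p q) E * (1 - \<pi> + \<pi> * 1) ^ d"
    using \<pi> by (intro prob_all_children_binomial) (auto simp: M_def)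
  then show ?case by simp
next
  case (Suc n)
  interpret M: prob_space M unfolding M_def by (rule prob_space_percolation)
  let ?P = "measure_pmf.prob (edge_label_pmf p q)"
  have space: "space M = UNIV" unfolding M_def by simp
  have [measurable]: "(\<lambda>\<omega>. snd \<omega> w) \<in> measurable M (count_space UNIV)"
      "Measurable.pred M (\<lambda>\<omega>. win_within (fst \<omega>) (snd \<omega>) n w)"
      "Measurable.pred M (\<lambda>\<omega>. lose_within (fst \<omega>) (snd \<omega>) n w)" for w n
    unfolding M_def by measurable
  have label: "measure M {\<omega>. snd \<omega> w \<in> E} = ?P E" for w E
  proof -
    have "measure M {\<omega>. snd \<omega> w \<in> E \<and> (\<forall>i<fst \<omega> w. True)} = ?P E * (1 - \<pi> + \<pi> * 1) ^ d"
      using \<pi> M.prob_space unfolding space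
      by (intro prob_all_children_binomial) (auto simp: M_def)
    then show ?thesis by simp
  qed
  have P: "?P {Trap, Safe} = 1 - q" "?P {Safe} = 1 - p - q"
    by (simp_all add: measure_measure_pmf_finite pmf_edge_label_pmf[OF pq])
  \<comment> \<open>Taking the complement within \<open>{Trap, Safe}\<close> leaves a
    \<open>Safe\<close> label together with \<open>\<not> R\<close>, which the induction hypothesis
    covers with \<open>E = {Safe}\<close>.\<close>
  have safe_child: "measure M {\<omega>. snd \<omega> w = Trap \<or> snd \<omega> w = Safe \<and> R \<omega>}
      = 1 - q - (1 - p - q) * x"
    if [measurable]: "Measurable.pred M R"
      and "measure M {\<omega>. snd \<omega> w \<in> {Safe} \<and> \<not> R \<omega>} = ?P {Safe} * x" for R w x
  proof -
    have "Measurable.pred M (\<lambda>\<omega>. snd \<omega> w \<in> {Trap, Safe})"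
      "Measurable.pred M (\<lambda>\<omega>. snd \<omega> w \<in> {Safe} \<and> \<not> R \<omega>)"
      by measurable
    then have "measure M ({\<omega>. snd \<omega> w \<in> {Trap, Safe}} - {\<omega>. snd \<omega> w \<in> {Safe} \<and> \<not> R \<omega>})
        = measure M {\<omega>. snd \<omega> w \<in> {Trap, Safe}} - measure M {\<omega>. snd \<omega> w \<in> {Safe} \<and> \<not> R \<omega>}"
      by (intro M.finite_measure_Diff) (auto simp: pred_def space)
    also have "\<dots> = 1 - q - (1 - p - q) * x"
      unfolding label that(2) P ..
    also have "{\<omega>. snd \<omega> w \<in> {Trap, Safe}} - {\<omega>. snd \<omega> w \<in> {Safe} \<and> \<not> R \<omega>}
        = {\<omega>. snd \<omega> w = Trap \<or> snd \<omega> w = Safe \<and> R \<omega>}"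
      by auto
    finally show ?thesis .
  qed
  have "measure M {\<omega>. snd \<omega> v \<in> E \<and> (\<forall>i<fst \<omega> v. snd \<omega> (v @ [i]) = Trap \<or>
        snd \<omega> (v @ [i]) = Safe \<and> win_within (fst \<omega>) (snd \<omega>) n (v @ [i]))}
      = ?P E * (1 - \<pi> + \<pi> * (1 - q - (1 - p - q) * nonwin_prob a b d n)) ^ d"
  proof (rule prob_all_children_binomial[OF M_def[THEN meta_eq_to_obj_eq] \<pi>])
    fix i
    show "Measurable.pred M (\<lambda>\<omega>. snd \<omega> (v @ [i]) = Trap \<or>
        snd \<omega> (v @ [i]) = Safe \<and> win_within (fst \<omega>) (snd \<omega>) n (v @ [i]))"
      by measurable
    show "measure M {\<omega>. snd \<omega> (v @ [i]) = Trap \<or>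
        snd \<omega> (v @ [i]) = Safe \<and> win_within (fst \<omega>) (snd \<omega>) n (v @ [i])}
        = 1 - q - (1 - p - q) * nonwin_prob a b d n"
      by (rule safe_child) (measurable, use Suc in blast)
  next
    fix i N L N' L'
    assume "\<And>u. N (v @ i # u) = N' (v @ i # u)" "\<And>u. L (v @ i # u) = L' (v @ i # u)"
      and win: "snd (N, L) (v @ [i]) = Trap \<or> snd (N, L) (v @ [i]) = Safe \<and>
        win_within (fst (N, L)) (snd (N, L)) n (v @ [i])"
    then have "L (v @ [i]) = L' (v @ [i])"
        "win_within N L n (v @ [i]) \<longleftrightarrow> win_within N' L' n (v @ [i])"
      using within_cong[of N "v @ [i]" N' L L' n] by simp_all
    with win show "snd (N', L') (v @ [i]) = Trap \<or> snd (N', L') (v @ [i]) = Safe \<and>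
        win_within (fst (N', L')) (snd (N', L')) n (v @ [i])"
      by simp
  qed
  moreover have "measure M {\<omega>. snd \<omega> v \<in> E \<and> (\<forall>i<fst \<omega> v. snd \<omega> (v @ [i]) = Trap \<or>
        snd \<omega> (v @ [i]) = Safe \<and> \<not> lose_within (fst \<omega>) (snd \<omega>) n (v @ [i]))}
      = ?P E * (1 - \<pi> + \<pi> * (1 - q - (1 - p - q) * lose_prob a b d n)) ^ d"
  proof (rule prob_all_children_binomial[OF M_def[THEN meta_eq_to_obj_eq] \<pi>])
    fix i
    show "Measurable.pred M (\<lambda>\<omega>. snd \<omega> (v @ [i]) = Trap \<or>
        snd \<omega> (v @ [i]) = Safe \<and> \<not> lose_within (fst \<omega>) (snd \<omega>) n (v @ [i]))"
      by measurable
    show "measure M {\<omega>. snd \<omega> (v @ [i]) = Trap \<or>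
        snd \<omega> (v @ [i]) = Safe \<and> \<not> lose_within (fst \<omega>) (snd \<omega>) n (v @ [i])}
        = 1 - q - (1 - p - q) * lose_prob a b d n"
      by (rule safe_child) (measurable, use Suc in \<open>unfold not_not, blast\<close>)
  next
    fix i N L N' L'
    assume "\<And>u. N (v @ i # u) = N' (v @ i # u)" "\<And>u. L (v @ i # u) = L' (v @ i # u)"
      and lose: "snd (N, L) (v @ [i]) = Trap \<or> snd (N, L) (v @ [i]) = Safe \<and>
        \<not> lose_within (fst (N, L)) (snd (N, L)) n (v @ [i])"
    then have "L (v @ [i]) = L' (v @ [i])"
        "lose_within N L n (v @ [i]) \<longleftrightarrow> lose_within N' L' n (v @ [i])"
      using within_cong[of N "v @ [i]" N' L L' n] by simp_all
    with lose show "snd (N', L') (v @ [i]) = Trap \<or> snd (N', L') (v @ [i]) = Safe \<and>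
        \<not> lose_within (fst (N', L')) (snd (N', L')) n (v @ [i])"
      by simp
  qed
  moreover have "1 - \<pi> + \<pi> * (1 - q - (1 - p - q) * x) = a - b * x" for x
    unfolding a_def b_def by (simp add: algebra_simps)
  \<comment> \<open>Negation turns the winning condition into one on all children, the form that the
    branching formula handles.\<close>
  moreover have "\<not> win_within N L (Suc n) v \<longleftrightarrow>
      (\<forall>i<N v. L (v @ [i]) = Trap \<or> L (v @ [i]) = Safe \<and> \<not> lose_within N L n (v @ [i]))" for N L
    unfolding win_within.simps by (metis edge_label.distinct edge_label.exhaust)
  ultimately show ?case by simp
qed

section \<open>The draw probability as a difference of limits\<close>

lemma game_drawn_iff: "game_drawn N L \<longleftrightarrow>
    (\<forall>n. \<not> win_within N L n []) \<and> \<not> (\<exists>n. lose_within N L n [])"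
  unfolding game_drawn_def game_won_iff game_lost_iff by blast

theorem theorem1p3:
  fixes d :: nat and \<pi> p q :: real
  assumes "2 \<le> d"
    and "0 < \<pi>" "\<pi> \<le> 1"
    and "p \<in> {0..1}" "q \<in> {0..1}"
    and "0 < p + q" "p + q < 1"
  shows "draw_event (binomial_pmf d \<pi>) p q \<in> sets (percolation_measure (binomial_pmf d \<pi>) p q) \<and>
    (measure (percolation_measure (binomial_pmf d \<pi>) p q) (draw_event (binomial_pmf d \<pi>) p q) = 0 \<longleftrightarrow>
      (1 - p - q) * \<pi> * (1 - \<pi> * q) ^ (d - 1) \<le> (real d + 1) ^ (d - 1) / real d ^ d)"
proof -
  define M where "M = percolation_measure (binomial_pmf d \<pi>) p q"
  define a b where "a = 1 - \<pi> * q" and "b = \<pi> * (1 - p - q)"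
  define Lose where "Lose n = {\<omega>. lose_within (fst \<omega>) (snd \<omega>) n []}" for n
  define Nonwin where "Nonwin n = {\<omega>. \<not> win_within (fst \<omega>) (snd \<omega>) n []}" for n
  interpret M: prob_space M unfolding M_def by (rule prob_space_percolation)
  have sets: "Lose n \<in> sets M" "Nonwin n \<in> sets M" for n
  proof -
    have "Measurable.pred M (\<lambda>\<omega>. lose_within (fst \<omega>) (snd \<omega>) n [])"
      "Measurable.pred M (\<lambda>\<omega>. \<not> win_within (fst \<omega>) (snd \<omega>) n [])"
      unfolding M_def by measurable
    then show "Lose n \<in> sets M" "Nonwin n \<in> sets M"
      unfolding Lose_def Nonwin_def M_def by (simp_all add: pred_def)
  qed
  have draw: "draw_event (binomial_pmf d \<pi>) p q = (\<Inter>n. Nonwin n) - (\<Union>n. Lose n)"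
    unfolding draw_event_def Nonwin_def Lose_def by (auto simp: game_drawn_iff)
  have prob: "M.prob (Lose n) = lose_prob a b d n" "M.prob (Nonwin n) = nonwin_prob a b d n" for n
    using prob_lose_and_nonwin[of \<pi> p q d "[]" UNIV n] assms
    unfolding Lose_def Nonwin_def M_def a_def b_def by simp_all
  have inc: "incseq Lose" and dec: "decseq Nonwin"
    unfolding Lose_def Nonwin_def
    by (auto intro!: incseq_SucI decseq_SucI intro: lose_within_mono win_within_mono
        simp del: lose_within.simps win_within.simps)
  have lim: "lose_prob a b d \<longlonglongrightarrow> M.prob (\<Union>n. Lose n)"
      "nonwin_prob a b d \<longlonglongrightarrow> M.prob (\<Inter>n. Nonwin n)"
    using M.finite_Lim_measure_incseq[OF _ inc] M.finite_Lim_measure_decseq[OF _ dec] sets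
    unfolding prob by auto
  \<comment> \<open>This inclusion makes the draw probability a plain difference of the two limits
    and orders them.\<close>
  have sub: "(\<Union>n. Lose n) \<subseteq> (\<Inter>n. Nonwin n)"
    unfolding Lose_def Nonwin_def using win_imp_not_lose by blast
  have draw_sets: "draw_event (binomial_pmf d \<pi>) p q \<in> sets M"
    unfolding draw using sets by auto
  have "M.prob (draw_event (binomial_pmf d \<pi>) p q)
      = M.prob (\<Inter>n. Nonwin n) - M.prob (\<Union>n. Lose n)"
    unfolding draw using sets sub by (intro M.finite_measure_Diff) auto
  moreover have "M.prob (\<Inter>n. Nonwin n) = M.prob (\<Union>n. Lose n) \<longleftrightarrow>
      b * a ^ (d - 1) \<le> (real d + 1) ^ (d - 1) / real d ^ d"
  proof (rule alternating_iteration_limits_eq_iff[OF \<open>2 \<le> d\<close>])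
    show "0 < b" unfolding b_def using assms by simp
    \<comment> \<open>The difference \<open>a - b\<close> equals
      \<open>1 - \<pi> * (1 - p)\<close>.\<close>
    have "\<pi> * (1 - p) \<le> 1" using assms by (intro mult_le_one) auto
    then show "b \<le> a" unfolding a_def b_def by (simp add: algebra_simps)
    show "a \<le> 1" unfolding a_def using assms by simp
    show "incseq (lose_prob a b d)"
      unfolding prob(1)[symmetric, abs_def] using inc sets
      by (auto intro!: M.finite_measure_mono simp: incseq_def)
    show "M.prob (\<Union>n. Lose n) \<le> M.prob (\<Inter>n. Nonwin n)"
      using sub sets by (intro M.finite_measure_mono) auto
    show "lose_prob a b d n \<in> {0..1}" "nonwin_prob a b d n \<in> {0..1}" for n
      unfolding prob[symmetric] by auto
  qed (use lim in auto)
  moreover have "b * a ^ (d - 1) = (1 - p - q) * \<pi> * (1 - \<pi> * q) ^ (d - 1)"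
    unfolding a_def b_def by simp
  ultimately show ?thesis
    using draw_sets unfolding M_def by simp
qed

end
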